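(* Let $N\ge8$ be an integer. Then there exist $\widetilde s_N\in(0,1)$ and families $(\ell_{1,s})_{0<s<\widetilde s_N}$, $(\ell_{2,s})_{0<s<\widetilde s_N}$ of real numbers (depending on $N$ and $s$) with $0<\ell_{1,s}<\ell_{2,s}$ for each $s\in(0,\widetilde s_N)$ such that: (i) if $s\in(0,\widetilde s_N)$ and $\ell\in(0,\ell_{1,s})$, then there exist $p_i=p_i(N,s,\ell)$ $(i=1,2)$ such that (a) $p_S(N,\ell)<p_1\le p_2<\infty$, (b) every $p\in(1,p_1)$ is JL-subcritical, (c) each $p\in(p_2,\infty)$ is JL-supercritical, (d) $p_1$ and $p_2$ are JL-critical; (ii) if $s\in(0,\widetilde s_N)$ and $\ell\in(\ell_{1,s},\ell_{2,s})$, then there exist $p_i=p_i(N,s,\ell)$ $(i=1,2,3,4)$ such that (a) $p_S(N,\ell)<p_1\le p_2<p_3\le p_4<\infty$, (b) every $p\in(1,p_1)\cup(p_4,\infty)$ is JL-subcritical, (c) each $p\in(p_2,p_3)$ is JL-supercritical, (d) $p_1,p_2,p_3$ and $p_4$ are JL-critical. In addition, there exist real numbers $(\ell_{3,s})_{0<s<1}$ when $N\ge10$, and $(\ell_{3,s})_{0<s<s_N}$ when $N=8,9$ (depending on $N$ and $s$), such that if $\ell\ge\ell_{3,s}$, then each $p>1$ is JL-subcritical.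
   Context: Throughout $0<s<1$ and $\ell>-2s$. Put $$p_S(N,\ell):=\frac{N+2s+2\ell}{N-2s},\qquad \lambda(\alpha):=2^{2s}\frac{\Gamma(\frac{N+2s+2\alpha}{4})\Gamma(\frac{N+2s-2\alpha}{4})}{\Gamma(\frac{N-2s-2\alpha}{4})\Gamma(\frac{N-2s+2\alpha}{4})}.$$ An exponent $p>1$ is called (for given $N,s,\ell$): - JL-subcritical if either $1<p\le p_S(N,\ell)$, or $p>p_S(N,\ell)$ and $p\,\lambda\big(\frac{N-2s}{2}-\frac{2s+\ell}{p-1}\big)>\lambda(0)$; - JL-supercritical if $p>p_S(N,\ell)$ and $p\,\lambda\big(\frac{N-2s}{2}-\frac{2s+\ell}{p-1}\big)<\lambda(0)$; - JL-critical if $p>p_S(N,\ell)$ and $p\,\lambda\big(\frac{N-2s}{2}-\frac{2s+\ell}{p-1}\big)=\lambda(0)$. For $N\in\{8,9\}$, $s_N\in(0,1)$ is the unique number with the following property for $\ell=0$: if $s_N\le s<1$, then every $p>1$ is JL-subcritical; if $0<s<s_N$, then there is $p_{JL}\in(p_S(N,0),\infty)$ such that every $p\in(1,p_{JL})$ is JL-subcritical, $p_{JL}$ is JL-critical, and every $p>p_{JL}$ is JL-supercritical (such $s_N$ is known to exist). *)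

theory Defs
  imports "HOL-Analysis.Analysis"
begin

definition p_S :: "nat \<Rightarrow> real \<Rightarrow> real \<Rightarrow> real" where
  "p_S N s l = (real N + 2 * s + 2 * l) / (real N - 2 * s)"

(* Gamma is a total function in the library, with value 0 at its poles.  Below, lam is only used
   at alpha = 0 and at alpha = (N - 2s)/2 - (2s + l)/(p - 1) with p > p_S N s l; for 0 < s < 1,
   l > -2s and N >= 2 these alpha lie in [0, (N - 2s)/2), so all Gamma arguments are positive. *)
definition lam :: "nat \<Rightarrow> real \<Rightarrow> real \<Rightarrow> real" where
  "lam N s \<alpha> = 2 powr (2 * s) *
     (Gamma ((real N + 2 * s + 2 * \<alpha>) / 4) * Gamma ((real N + 2 * s - 2 * \<alpha>) / 4)) /
     (Gamma ((real N - 2 * s - 2 * \<alpha>) / 4) * Gamma ((real N - 2 * s + 2 * \<alpha>) / 4))"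

definition JL_subcritical :: "nat \<Rightarrow> real \<Rightarrow> real \<Rightarrow> real \<Rightarrow> bool" where
  "JL_subcritical N s l p \<longleftrightarrow> 1 < p \<and>
     (p \<le> p_S N s l \<or>
      p > p_S N s l \<and> p * lam N s ((real N - 2 * s) / 2 - (2 * s + l) / (p - 1)) > lam N s 0)"

definition JL_supercritical :: "nat \<Rightarrow> real \<Rightarrow> real \<Rightarrow> real \<Rightarrow> bool" where
  "JL_supercritical N s l p \<longleftrightarrow> 1 < p \<and>
     p > p_S N s l \<and> p * lam N s ((real N - 2 * s) / 2 - (2 * s + l) / (p - 1)) < lam N s 0"

definition JL_critical :: "nat \<Rightarrow> real \<Rightarrow> real \<Rightarrow> real \<Rightarrow> bool" where
  "JL_critical N s l p \<longleftrightarrow> 1 < p \<and>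
     p > p_S N s l \<and> p * lam N s ((real N - 2 * s) / 2 - (2 * s + l) / (p - 1)) = lam N s 0"

(* The property characterising the number s_N (N = 8, 9); it determines s_N by
   s_threshold_unique. *)
definition is_s_threshold :: "nat \<Rightarrow> real \<Rightarrow> bool" where
  "is_s_threshold N sN \<longleftrightarrow> 0 < sN \<and> sN < 1 \<and>
     (\<forall>s. sN \<le> s \<and> s < 1 \<longrightarrow> (\<forall>p>1. JL_subcritical N s 0 p)) \<and>
     (\<forall>s. 0 < s \<and> s < sN \<longrightarrow>
        (\<exists>p_JL>p_S N s 0.
           (\<forall>p. 1 < p \<and> p < p_JL \<longrightarrow> JL_subcritical N s 0 p) \<and>
           JL_critical N s 0 p_JL \<and>
           (\<forall>p>p_JL. JL_supercritical N s 0 p)))"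

lemma s_threshold_unique:
  assumes "is_s_threshold N a" "is_s_threshold N b"
  shows "a = b"
proof -
  have *: False if a: "is_s_threshold N x" and b: "is_s_threshold N y" and "x < y" for x y
  proof -
    have "0 < x" and "y < 1" using a b by (auto simp: is_s_threshold_def)
    then have sub: "\<forall>p>1. JL_subcritical N x 0 p"
      using a b \<open>x < y\<close> by (auto simp: is_s_threshold_def)
    obtain q where "\<forall>p>q. JL_supercritical N x 0 p"
      using b \<open>0 < x\<close> \<open>x < y\<close> unfolding is_s_threshold_def by blast
    then have "JL_supercritical N x 0 (max q 1 + 1)" by simp
    moreover have "JL_subcritical N x 0 (max q 1 + 1)" using sub by simp
    ultimately show False by (auto simp: JL_supercritical_def JL_subcritical_def)
  qed
  then show ?thesis using assms by (metis linorder_neqE_linordered_idom)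
qed

end

theory Submission
  imports Defs
begin

text \<open>
  Put \<open>M = N/2\<close>.  For \<open>p > p_S N s l\<close> the substitution \<open>x = (s + l/2) / (p - 1)\<close> is a
  decreasing bijection onto \<open>(0, (M - s)/2)\<close>; it sends \<open>p \<rightarrow> \<infinity>\<close> to \<open>x \<rightarrow> 0\<close> and
  \<open>p \<rightarrow> p_S\<close> to \<open>x \<rightarrow> (M - s)/2\<close>.  Since \<open>p x = x + s + l/2\<close>, the expression compared with
  \<open>\<lambda>(0)\<close> is affine in \<open>l\<close> for fixed \<open>x\<close>, and solving for \<open>l\<close> shows that \<open>p\<close> is JL-subcritical, JL-critical or
  JL-supercritical according to whether \<open>l/2\<close> is above, on or below the graph of a function
  \<open>h x = (x + s) (R s x - 1)\<close> that does not involve \<open>l\<close>, where \<open>R\<close> is a quotient of Gamma values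
  (\<open>JL_iff_profile\<close>).

  The claim on large \<open>l\<close> is then the boundedness of the continuous function \<open>h\<close> on the
  compact interval \<open>[0, (M - s)/2]\<close>.

  For the claims on small \<open>s\<close>, \<open>h\<close> has the value \<open>-s < 0\<close> at the right end of the interval.  Moreover
  \<open>R 0 x = 1\<close>, and the derivative of \<open>R\<close> in \<open>s\<close> at \<open>s = 0\<close> is
  \<open>2 \<psi>(M/2) - \<psi>(M - x) - \<psi>(x + 1)\<close> with \<open>\<psi>\<close> the digamma function.  This is positive at \<open>x = 0\<close>
  for \<open>M \<ge> 4\<close> (\<open>Digamma_gap_pos\<close>), hence also at some \<open>x0 > 0\<close>.  As \<open>s \<rightarrow> 0\<close>, therefore,
  \<open>h x0\<close> is positive of order \<open>s\<close>, whereas \<open>h 0 = s (R s 0 - 1)\<close> is positive but of order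
  \<open>s\<^sup>2\<close>, so that \<open>0 < h 0 < h x0\<close> for all small \<open>s\<close> (\<open>JL_profile_small_s\<close>).  One takes
  \<open>l1 = 2 h 0\<close> and \<open>l2 = 2 h x0\<close>.  For \<open>0 < l < l1\<close> the level \<open>l/2\<close> is crossed from above to below
  on \<open>[0, (M - s)/2]\<close>; for \<open>l1 < l < l2\<close> it is crossed from below to above on \<open>[0, x0]\<close>
  and from above to below on \<open>[x0, (M - s)/2]\<close>.  The first and last points of these crossings correspond to the
  exponents \<open>p\<^sub>i\<close>, in reversed order.
\<close>

section \<open>Level crossings of a continuous function\<close>

text \<open>
  The points \<open>u\<close> and \<open>v\<close> are the first and the last point at which \<open>h\<close> takes the value \<open>m\<close>.
\<close>

lemma crossing_down:
  fixes h :: "real \<Rightarrow> real"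
  assumes ab: "a \<le> b" and cont: "continuous_on {a..b} h" and ha: "m < h a" and hb: "h b < m"
  obtains u v where "a < u" "u \<le> v" "v < b" "h u = m" "h v = m"
    "\<And>x. a \<le> x \<Longrightarrow> x < u \<Longrightarrow> m < h x" "\<And>x. v < x \<Longrightarrow> x \<le> b \<Longrightarrow> h x < m"
proof -
  define Z where "Z = {x \<in> {a..b}. h x = m}"
  have "closed Z"
    unfolding Z_def by (rule continuous_closed_preimage_constant[OF cont closed_atLeastAtMost])
  moreover have "bounded Z"
    by (rule bounded_subset[OF bounded_closed_interval[of a b]]) (auto simp: Z_def)
  ultimately have "compact Z"
    by (simp add: compact_eq_bounded_closed)
  moreover have "Z \<noteq> {}"
    using IVT2'[of h b m a] assms unfolding Z_def by force
  ultimately obtain u v where uv: "u \<in> Z" "v \<in> Z" "\<And>x. x \<in> Z \<Longrightarrow> u \<le> x" "\<And>x. x \<in> Z \<Longrightarrow> x \<le> v"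
    by (metis compact_attains_inf compact_attains_sup)
  show ?thesis
  proof (rule that[of u v])
    show "h u = m" "h v = m" "u \<le> v" using uv by (auto simp: Z_def)
    show "a < u" "v < b" using uv ha hb by (auto simp: Z_def order_less_le)
    show "m < h x" if x: "a \<le> x" "x < u" for x
    proof (rule ccontr)
      assume "\<not> m < h x"
      then obtain z where "a \<le> z" "z \<le> x" "h z = m"
        using IVT2'[of h x m a] x ha uv continuous_on_subset[OF cont, of "{a..x}"]
        by (force simp: Z_def)
      then show False using uv(1) uv(3)[of z] x by (auto simp: Z_def)
    qed
    show "h x < m" if x: "v < x" "x \<le> b" for x
    proof (rule ccontr)
      assume "\<not> h x < m"
      then obtain z where "x \<le> z" "z \<le> b" "h z = m"
        using IVT2'[of h b m x] x hb uv continuous_on_subset[OF cont, of "{x..b}"]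
        by (force simp: Z_def)
      then show False using uv(2) uv(4)[of z] x by (auto simp: Z_def)
    qed
  qed
qed

lemma crossing_up:
  fixes h :: "real \<Rightarrow> real"
  assumes "a \<le> b" "continuous_on {a..b} h" "h a < m" "m < h b"
  obtains u v where "a < u" "u \<le> v" "v < b" "h u = m" "h v = m"
    "\<And>x. a \<le> x \<Longrightarrow> x < u \<Longrightarrow> h x < m" "\<And>x. v < x \<Longrightarrow> x \<le> b \<Longrightarrow> m < h x"
  using crossing_down[of a b "\<lambda>x. - h x" "- m"] assms
  by (auto simp: continuous_on_minus)

section \<open>The digamma inequality\<close>

lemma not_nonpos_Int [simp]: "(z::real) > 0 \<Longrightarrow> z \<notin> \<int>\<^sub>\<le>\<^sub>0"
  by (auto elim!: nonpos_Ints_cases)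

lemma Gamma_real_nonzero [simp]: "(z::real) > 0 \<Longrightarrow> Gamma z \<noteq> 0"
  by (simp add: Gamma_eq_zero_iff)

text \<open>
  The difference \<open>2 \<psi>(M/2) - \<psi>(M)\<close> is nondecreasing in \<open>M\<close> because \<open>\<psi>'\<close> is decreasing, and at
  \<open>M = 4\<close> the left-hand side below equals \<open>1/6\<close>.
\<close>

lemma Digamma_gap_pos:
  fixes M :: real
  assumes "M \<ge> 4"
  shows "2 * Digamma (M / 2) - Digamma M - Digamma 1 > 0"
proof -
  let ?f = "\<lambda>y::real. 2 * Digamma (y / 2) - Digamma y"
  have "?f 4 \<le> ?f M"
  proof (rule DERIV_nonneg_imp_nondecreasing[OF assms])
    fix y :: real
    assume y: "4 \<le> y"
    have "(?f has_real_derivative (Polygamma 1 (y / 2) - Polygamma 1 y)) (at y)"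
      using y by (auto intro!: derivative_eq_intros)
    moreover have "Polygamma 1 (y / 2) - Polygamma 1 y \<ge> 0"
      using Polygamma_real_strict_antimono[of "y / 2" y 1] y by simp
    ultimately show "\<exists>d. (?f has_real_derivative d) (at y) \<and> d \<ge> 0" by blast
  qed
  moreover have "?f 4 - Digamma 1 = 1 / 6"
    by (simp add: Digamma_numeral harm_expand)
  ultimately show ?thesis by simp
qed

section \<open>The profile function\<close>

text \<open>
  The quotient \<open>R\<close>, with \<open>M\<close> in the role of \<open>N/2\<close>.  Its denominator contains \<open>\<Gamma>(x + s + 1)\<close>
  rather than \<open>\<Gamma>(x + s)\<close>, so that it is regular at \<open>x = s = 0\<close>.
\<close>

definition Gamma_quot :: "real \<Rightarrow> real \<Rightarrow> real \<Rightarrow> real" where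
  "Gamma_quot M s x = (Gamma ((M + s) / 2) / Gamma ((M - s) / 2))\<^sup>2 *
     (Gamma (M - x - s) * Gamma (x + 1)) / (Gamma (M - x) * Gamma (x + s + 1))"

text \<open>
  The function \<open>h\<close>: for \<open>0 < x < (M - s)/2\<close> its value at \<open>x\<close> is the value of \<open>l/2 > -s\<close> for
  which the exponent \<open>p = 1 + (s + l/2) / x\<close> is JL-critical.
\<close>

definition JL_profile :: "real \<Rightarrow> real \<Rightarrow> real \<Rightarrow> real" where
  "JL_profile M s x = (x + s) * (Gamma_quot M s x - 1)"

lemma continuous_on_JL_profile:
  assumes "0 < s" "s < 1" "1 < M"
  shows "continuous_on {0..(M - s) / 2} (JL_profile M s)"
proof -
  have *: "0 < M - x" "0 < M - x - s" if "x \<le> (M - s) / 2" for x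
    using that assms by (simp_all add: field_simps)
  have nz: "Gamma (M - x) \<noteq> 0" "Gamma (x + s + 1) \<noteq> 0" if "0 \<le> x" "x \<le> (M - s) / 2" for x
    using *[of x] that assms by simp_all
  have Gamma_comp: "continuous_on S (\<lambda>x. Gamma (g x))"
    if "continuous_on S g" "\<And>x. x \<in> S \<Longrightarrow> 0 < g x" for S and g :: "real \<Rightarrow> real"
    by (rule continuous_on_compose2[OF continuous_on_Gamma[of "{0<..}"] that(1)]) (use that(2) in auto)
  show ?thesis
    unfolding JL_profile_def Gamma_quot_def
    by (intro continuous_on_mult continuous_on_diff continuous_on_divide continuous_on_add
        continuous_on_const continuous_on_id Gamma_comp) (use * nz assms in auto)
qed

lemma JL_profile_right_end:
  assumes "0 < s" "s < M"
  shows "JL_profile M s ((M - s) / 2) = - s"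
proof -
  let ?x = "(M - s) / 2"
  have eqs: "M - ?x - s = ?x" "M - ?x = (M + s) / 2" "?x + s = (M + s) / 2"
    by (simp_all add: field_simps)
  have nz: "Gamma ?x \<noteq> 0" "Gamma ((M + s) / 2) \<noteq> 0"
    using assms by (intro Gamma_real_nonzero; simp)+
  have G: "Gamma (?x + 1) = ?x * Gamma ?x" "Gamma ((M + s) / 2 + 1) = (M + s) / 2 * Gamma ((M + s) / 2)"
    using assms by (intro Gamma_plus1; simp)+
  have "Gamma_quot M s ?x = ?x / ((M + s) / 2)"
    unfolding Gamma_quot_def eqs G
    using nz assms by (simp add: power2_eq_square divide_simps) (simp add: algebra_simps)
  then show ?thesis
    unfolding JL_profile_def eqs using assms by (simp add: field_simps)
qed

lemma Gamma_quot_0: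
  assumes "0 \<le> x" "x < M"
  shows "Gamma_quot M 0 x = 1"
  using assms by (simp add: Gamma_quot_def)

lemma has_derivative_Gamma_quot:
  assumes "0 \<le> x" "x < M"
  shows "((\<lambda>s. Gamma_quot M s x) has_real_derivative
           2 * Digamma (M / 2) - Digamma (M - x) - Digamma (x + 1)) (at 0)"
proof -
  have nz: "Gamma (M / 2) \<noteq> 0" "Gamma (M - x) \<noteq> 0" "Gamma (x + 1) \<noteq> 0"
    using assms by simp_all
  have D:
    "((\<lambda>s. Gamma ((M + s) / 2)) has_real_derivative
       Gamma (M / 2) * Digamma (M / 2) / 2) (at 0)"
    "((\<lambda>s. Gamma ((M - s) / 2)) has_real_derivative
       - (Gamma (M / 2) * Digamma (M / 2) / 2)) (at 0)"
    "((\<lambda>s. Gamma (M - x - s)) has_real_derivative - (Gamma (M - x) * Digamma (M - x))) (at 0)"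
    "((\<lambda>s. Gamma (x + s + 1)) has_real_derivative Gamma (x + 1) * Digamma (x + 1)) (at 0)"
    using assms by (auto intro!: derivative_eq_intros)
  \<comment> \<open>The derivative at \<open>0\<close> of a quotient of this shape from the logarithmic derivatives of its factors.\<close>
  have quot: "((\<lambda>s. (f s / g s)\<^sup>2 * (u s * c) / (b * v s)) has_real_derivative
      2 * \<alpha> - \<beta> - \<gamma>) (at 0)"
    if "(f has_real_derivative a * \<alpha> / 2) (at 0)" "(g has_real_derivative - (a * \<alpha> / 2)) (at 0)"
      "(u has_real_derivative - (b * \<beta>)) (at 0)" "(v has_real_derivative c * \<gamma>) (at 0)"
      "f 0 = a" "g 0 = a" "u 0 = b" "v 0 = c" "a \<noteq> 0" "b \<noteq> 0" "c \<noteq> 0"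
    for f g u v :: "real \<Rightarrow> real" and a b c \<alpha> \<beta> \<gamma>
    by (rule derivative_eq_intros that(1-4) refl | use that(5-) in \<open>simp; fail\<close>)+
       (use that(5-) in \<open>simp add: field_simps power2_eq_square\<close>)
  show ?thesis
    unfolding Gamma_quot_def by (rule quot[OF D _ _ _ _ nz]) simp_all
qed

text \<open>
  The point \<open>x0\<close> does not depend on \<open>s\<close>.  The difference of the two profile values
  vanishes at \<open>s = 0\<close> and has there the derivative
  \<open>x0 (2 \<psi>(M/2) - \<psi>(M - x0) - \<psi>(x0 + 1))\<close>: the subtracted term \<open>h 0 = s (R s 0 - 1)\<close> is a
  product of two factors that vanish at \<open>s = 0\<close> and contributes nothing.
\<close>

lemma JL_profile_small_s:
  assumes "M \<ge> 4"
  obtains x0 d where "0 < x0" "x0 < 1" "0 < d" "d < 1"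
    "\<And>s. 0 < s \<Longrightarrow> s < d \<Longrightarrow> 0 < JL_profile M s 0 \<and> JL_profile M s 0 < JL_profile M s x0"
proof -
  let ?B = "\<lambda>x. 2 * Digamma (M / 2) - Digamma (M - x) - Digamma (x + 1)"
  have B0: "?B 0 > 0" using Digamma_gap_pos[OF assms] by simp
  have "isCont ?B 0"
    using assms by (auto intro!: continuous_intros)
  then have "eventually (\<lambda>x. ?B x > 0) (at_right 0)"
    using B0 by (intro order_tendstoD) (simp_all only: isCont_def filterlim_at_split)
  then obtain e where e: "e > 0" "\<And>x. 0 < x \<Longrightarrow> x < e \<Longrightarrow> ?B x > 0"
    unfolding eventually_at_right_field by auto
  define x0 where "x0 = min e 1 / 2"
  have x0: "0 < x0" "x0 < 1" "?B x0 > 0" using e by (auto simp: x0_def min_def)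
  have D0: "((\<lambda>s. Gamma_quot M s 0) has_real_derivative ?B 0) (at 0)"
    using has_derivative_Gamma_quot[of 0 M] assms by simp
  have Dx: "((\<lambda>s. Gamma_quot M s x0) has_real_derivative ?B x0) (at 0)"
    using has_derivative_Gamma_quot[of x0 M] assms x0 by simp
  have "((\<lambda>s. JL_profile M s x0 - JL_profile M s 0) has_real_derivative x0 * ?B x0) (at 0)"
    unfolding JL_profile_def using x0 assms
    by (auto intro!: derivative_eq_intros D0 Dx simp: Gamma_quot_0)
  from DERIV_pos_inc_right[OF this] x0 obtain d1 where
    d1: "d1 > 0" "\<And>s. 0 < s \<Longrightarrow> s < d1 \<Longrightarrow> JL_profile M s x0 - JL_profile M s 0 > 0"
    using assms by (auto simp: JL_profile_def Gamma_quot_0)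
  from DERIV_pos_inc_right[OF D0 B0] obtain d2 where
    d2: "d2 > 0" "\<And>s. 0 < s \<Longrightarrow> s < d2 \<Longrightarrow> Gamma_quot M s 0 > 1"
    using assms by (auto simp: Gamma_quot_0)
  show ?thesis
  proof (rule that[of x0 "min (min d1 d2) (1 / 2)"])
    fix s assume s: "0 < s" "s < min (min d1 d2) (1 / 2)"
    then show "0 < JL_profile M s 0 \<and> JL_profile M s 0 < JL_profile M s x0"
      using d1(2)[of s] d2(2)[of s] by (auto simp: JL_profile_def)
  qed (use x0 d1 d2 in auto)
qed

section \<open>Criticality of exponents in terms of the profile\<close>

lemma p_S_less_iff:
  assumes "0 < s" "2 * s < real N" "- 2 * s < l" "1 < p"
  shows "p_S N s l < p \<longleftrightarrow> (s + l / 2) / (p - 1) < (real N / 2 - s) / 2"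
  unfolding p_S_def using assms by (auto simp: field_simps)

text \<open>
  With \<open>t = 2 x\<close>, the Gamma arguments in \<open>lam N s ((N - 2 s)/2 - t)\<close> are \<open>M - x\<close>, \<open>x + s\<close>, \<open>x\<close> and
  \<open>M - x - s\<close>; the factor \<open>p = (x + s + l/2) / x\<close> turns \<open>\<Gamma>(x)\<close> in the
  denominator into \<open>\<Gamma>(x + 1)\<close>.  The constant
  \<open>c\<close> is \<open>2 powr (2 s)\<close> times the resulting quotient of Gamma values.
\<close>

lemma lam_eq_profile:
  fixes N :: nat and s l p :: real
  defines "M \<equiv> real N / 2" and "x \<equiv> (s + l / 2) / (p - 1)"
  assumes s: "0 < s" "s < M" and l: "- 2 * s < l" and p: "1 < p" and x: "x < (M - s) / 2"
  obtains c where "c > 0"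
    "p * lam N s ((real N - 2 * s) / 2 - (2 * s + l) / (p - 1))
       = lam N s 0 + c * (l / 2 - JL_profile M s x)"
proof -
  have x0: "0 < x" using p l by (simp add: x_def)
  have px: "p * x = x + s + l / 2" using p by (simp add: x_def field_simps)
  have xM: "0 < M - x" "0 < M - x - s" using x s by (auto simp: field_simps)
  have t: "(2 * s + l) / (p - 1) = 2 * x" using p by (simp add: x_def field_simps)
  let ?G = "Gamma (M - x) * Gamma (x + s) / (Gamma (x + 1) * Gamma (M - x - s))"
  let ?L = "(Gamma ((M + s) / 2) / Gamma ((M - s) / 2))\<^sup>2"
  have pos: "Gamma (M - x) > 0" "Gamma (x + s) > 0" "Gamma x > 0" "Gamma (x + 1) > 0"
    "Gamma (M - x - s) > 0" "Gamma ((M - s) / 2) > 0"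
    using x0 s xM by auto
  have args: "(real N + 2 * s + 2 * ((real N - 2 * s) / 2 - 2 * x)) / 4 = M - x"
    "(real N + 2 * s - 2 * ((real N - 2 * s) / 2 - 2 * x)) / 4 = x + s"
    "(real N - 2 * s - 2 * ((real N - 2 * s) / 2 - 2 * x)) / 4 = x"
    "(real N - 2 * s + 2 * ((real N - 2 * s) / 2 - 2 * x)) / 4 = M - x - s"
    "(real N + 2 * s + 2 * 0) / 4 = (M + s) / 2" "(real N + 2 * s - 2 * 0) / 4 = (M + s) / 2"
    "(real N - 2 * s + 2 * 0) / 4 = (M - s) / 2" "(real N - 2 * s - 2 * 0) / 4 = (M - s) / 2"
    by (simp_all add: M_def field_simps)
  have G1: "Gamma (x + 1) = x * Gamma x" using x0 by (intro Gamma_plus1) simp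
  have G2: "Gamma (x + s + 1) = (x + s) * Gamma (x + s)" using x0 s by (intro Gamma_plus1) simp
  have lam0: "lam N s 0 = 2 powr (2 * s) * ?L"
    unfolding lam_def args by (simp add: power2_eq_square)
  have "p * lam N s ((real N - 2 * s) / 2 - 2 * x) = 2 powr (2 * s) * ((p * x) * ?G)"
    unfolding lam_def args G1 using pos x0 by (simp add: field_simps)
  then have plam: "p * lam N s ((real N - 2 * s) / 2 - 2 * x)
      = 2 powr (2 * s) * ((x + s + l / 2) * ?G)"
    by (simp only: px)
  have "(x + s) * Gamma_quot M s x * ?G = ?L"
    unfolding Gamma_quot_def G2 using pos x0 s by (simp add: divide_simps)
  then have prof: "?G * (l / 2 - JL_profile M s x) = (x + s + l / 2) * ?G - ?L"
    unfolding JL_profile_def by (simp only: algebra_simps)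
  show ?thesis
  proof (rule that[of "2 powr (2 * s) * ?G"])
    show "2 powr (2 * s) * ?G > 0" using pos by simp
    show "p * lam N s ((real N - 2 * s) / 2 - (2 * s + l) / (p - 1))
        = lam N s 0 + 2 powr (2 * s) * ?G * (l / 2 - JL_profile M s x)"
      unfolding t plam lam0 mult.assoc prof by (simp only: algebra_simps)
  qed
qed

lemma JL_iff_profile:
  fixes N :: nat and s l p :: real
  defines "M \<equiv> real N / 2" and "x \<equiv> (s + l / 2) / (p - 1)"
  assumes s: "0 < s" "s < M" and l: "- 2 * s < l" and p: "1 < p"
  shows "JL_subcritical N s l p \<longleftrightarrow> (M - s) / 2 \<le> x \<or> JL_profile M s x < l / 2"
    and "JL_supercritical N s l p \<longleftrightarrow> x < (M - s) / 2 \<and> l / 2 < JL_profile M s x"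
    and "JL_critical N s l p \<longleftrightarrow> x < (M - s) / 2 \<and> JL_profile M s x = l / 2"
proof -
  have pS: "p_S N s l < p \<longleftrightarrow> x < (M - s) / 2"
    using p_S_less_iff[of s N l p] s l p by (simp add: M_def x_def)
  have "(JL_subcritical N s l p \<longleftrightarrow> (M - s) / 2 \<le> x \<or> JL_profile M s x < l / 2) \<and>
      (JL_supercritical N s l p \<longleftrightarrow> x < (M - s) / 2 \<and> l / 2 < JL_profile M s x) \<and>
      (JL_critical N s l p \<longleftrightarrow> x < (M - s) / 2 \<and> JL_profile M s x = l / 2)"
  proof (cases "x < (M - s) / 2")
    case True
    then obtain c where c: "c > 0"
      "p * lam N s ((real N - 2 * s) / 2 - (2 * s + l) / (p - 1))
         = lam N s 0 + c * (l / 2 - JL_profile M s x)"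
      using lam_eq_profile[of s N l p] s l p unfolding M_def x_def by auto
    show ?thesis
      unfolding JL_subcritical_def JL_supercritical_def JL_critical_def c(2)
      using pS True p c(1) by (auto simp: zero_less_mult_iff mult_less_0_iff)
  next
    case False
    then show ?thesis
      unfolding JL_subcritical_def JL_supercritical_def JL_critical_def
      using pS p by auto
  qed
  then show "JL_subcritical N s l p \<longleftrightarrow> (M - s) / 2 \<le> x \<or> JL_profile M s x < l / 2"
    and "JL_supercritical N s l p \<longleftrightarrow> x < (M - s) / 2 \<and> l / 2 < JL_profile M s x"
    and "JL_critical N s l p \<longleftrightarrow> x < (M - s) / 2 \<and> JL_profile M s x = l / 2"
    by blast+
qed

text \<open>The inverse of the substitution \<open>p \<mapsto> (s + l/2) / (p - 1)\<close>.\<close>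

definition exponent_of :: "real \<Rightarrow> real \<Rightarrow> real \<Rightarrow> real" where
  "exponent_of s l x = 1 + (s + l / 2) / x"

lemma exponent_of:
  assumes "- 2 * s < l" "0 < x"
  shows "1 < exponent_of s l x"
    and "(s + l / 2) / (exponent_of s l x - 1) = x"
    and "0 < y \<Longrightarrow> exponent_of s l x < exponent_of s l y \<longleftrightarrow> y < x"
    and "0 < y \<Longrightarrow> exponent_of s l x \<le> exponent_of s l y \<longleftrightarrow> y \<le> x"
    and "1 < p \<Longrightarrow> p < exponent_of s l x \<longleftrightarrow> x < (s + l / 2) / (p - 1)"
    and "1 < p \<Longrightarrow> exponent_of s l x < p \<longleftrightarrow> (s + l / 2) / (p - 1) < x"
proof -
  have c: "0 < s + l / 2" using assms by simp
  show "1 < exponent_of s l x" "(s + l / 2) / (exponent_of s l x - 1) = x"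
    using c assms by (simp_all add: exponent_of_def)
  show "0 < y \<Longrightarrow> exponent_of s l x < exponent_of s l y \<longleftrightarrow> y < x"
    "0 < y \<Longrightarrow> exponent_of s l x \<le> exponent_of s l y \<longleftrightarrow> y \<le> x"
    using c assms(2) unfolding exponent_of_def
    by (smt (verit) divide_strict_left_mono divide_left_mono mult_pos_pos)+
  show "1 < p \<Longrightarrow> p < exponent_of s l x \<longleftrightarrow> x < (s + l / 2) / (p - 1)"
    "1 < p \<Longrightarrow> exponent_of s l x < p \<longleftrightarrow> (s + l / 2) / (p - 1) < x"
    using assms unfolding exponent_of_def by (auto simp: field_simps)
qed

section \<open>Exponents for large, small and intermediate l\<close>

lemma subcritical_if_l_large:
  fixes N :: nat and s :: real
  assumes "0 < s" "s < 1" "N \<ge> 8"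
  shows "\<exists>L. \<forall>l. l > - 2 * s \<and> l \<ge> L \<longrightarrow> (\<forall>p>1. JL_subcritical N s l p)"
proof -
  define M where "M = real N / 2"
  have M: "M \<ge> 4" using assms by (simp add: M_def)
  have "compact (JL_profile M s ` {0..(M - s) / 2})"
    using assms M by (intro compact_continuous_image continuous_on_JL_profile) auto
  then obtain B where B: "\<And>x. 0 \<le> x \<Longrightarrow> x \<le> (M - s) / 2 \<Longrightarrow> JL_profile M s x \<le> B"
    using bounded_imp_bdd_above[OF compact_imp_bounded] unfolding bdd_above_def
    by (metis atLeastAtMost_iff imageI)
  have "JL_subcritical N s l p" if l: "l > - 2 * s" "l \<ge> 2 * (B + 1)" and p: "p > 1" for l p
  proof -
    define x where "x = (s + l / 2) / (p - 1)"
    have "0 < x" using l p by (simp add: x_def)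
    then have "(M - s) / 2 \<le> x \<or> JL_profile M s x < l / 2"
      using B[of x] l by fastforce
    then show ?thesis
      using JL_iff_profile(1)[of s N l p] assms M l p by (simp add: M_def x_def)
  qed
  then show ?thesis by blast
qed

lemma exponents_small_l:
  fixes N :: nat and s l :: real
  defines "M \<equiv> real N / 2"
  assumes s: "0 < s" "s < 1" and N: "N \<ge> 8" and l: "0 < l" "l / 2 < JL_profile M s 0"
  shows "\<exists>p1 p2. p_S N s l < p1 \<and> p1 \<le> p2 \<and>
              (\<forall>p. 1 < p \<and> p < p1 \<longrightarrow> JL_subcritical N s l p) \<and>
              (\<forall>p. p2 < p \<longrightarrow> JL_supercritical N s l p) \<and>
              JL_critical N s l p1 \<and> JL_critical N s l p2"
proof -
  have M: "M \<ge> 4" using N by (simp add: M_def)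
  let ?h = "JL_profile M s" and ?b = "(M - s) / 2" and ?q = "exponent_of s l"
  have l': "- 2 * s < l" using s l by simp
  obtain u v where uv: "0 < u" "u \<le> v" "v < ?b" "?h u = l / 2" "?h v = l / 2"
    "\<And>x. 0 \<le> x \<Longrightarrow> x < u \<Longrightarrow> l / 2 < ?h x" "\<And>x. v < x \<Longrightarrow> x \<le> ?b \<Longrightarrow> ?h x < l / 2"
    by (rule crossing_down[of 0 ?b ?h "l / 2"])
       (use continuous_on_JL_profile[of s M] JL_profile_right_end[of s M] s M l in auto)
  note iff = JL_iff_profile[of s N l, folded M_def, OF s(1) _ l']
  note q = exponent_of[OF l']
  have v: "0 < v" using uv by simp
  have crit: "JL_critical N s l (?q u)" "JL_critical N s l (?q v)"
    using iff(3)[of "?q u", unfolded q(2)[OF uv(1)]] iff(3)[of "?q v", unfolded q(2)[OF v]]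
      q(1)[OF uv(1)] q(1)[OF v] s M uv(2-5) by simp_all
  have sub: "JL_subcritical N s l p" if "1 < p" "p < ?q v" for p
    using iff(1)[of p] that q(5)[OF v] s M uv(7)[of "(s + l / 2) / (p - 1)"] by fastforce
  have super: "JL_supercritical N s l p" if "?q u < p" for p
  proof -
    define x where "x = (s + l / 2) / (p - 1)"
    have p: "1 < p" using that q(1)[OF uv(1)] by simp
    have "0 < x" using p l' by (simp add: x_def)
    moreover have "x < u" using that q(6)[OF uv(1) p] by (simp add: x_def)
    ultimately show ?thesis
      using iff(2)[of p, folded x_def] p s M uv(2,3) uv(6)[of x] by simp
  qed
  have "?q v \<le> ?q u" using q(4)[OF v uv(1)] uv(2) by simp
  moreover have "p_S N s l < ?q v" using crit(2) by (simp add: JL_critical_def)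
  ultimately show ?thesis using crit sub super by blast
qed

text \<open>
  The bound \<open>x0 < 1\<close> is only there to place \<open>x0\<close> inside \<open>(0, (M - s)/2)\<close>.
\<close>

lemma exponents_intermediate_l:
  fixes N :: nat and s l x0 :: real
  defines "M \<equiv> real N / 2"
  assumes s: "0 < s" "s < 1" and N: "N \<ge> 8" and l: "0 < l" and x0: "0 < x0" "x0 < 1"
    and h: "JL_profile M s 0 < l / 2" "l / 2 < JL_profile M s x0"
  shows "\<exists>p1 p2 p3 p4. p_S N s l < p1 \<and> p1 \<le> p2 \<and> p2 < p3 \<and> p3 \<le> p4 \<and>
              (\<forall>p. (1 < p \<and> p < p1) \<or> p4 < p \<longrightarrow> JL_subcritical N s l p) \<and>
              (\<forall>p. p2 < p \<and> p < p3 \<longrightarrow> JL_supercritical N s l p) \<and>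
              JL_critical N s l p1 \<and> JL_critical N s l p2 \<and>
              JL_critical N s l p3 \<and> JL_critical N s l p4"
proof -
  have M: "M \<ge> 4" using N by (simp add: M_def)
  let ?h = "JL_profile M s" and ?b = "(M - s) / 2" and ?q = "exponent_of s l"
  have l': "- 2 * s < l" using s l by simp
  have x0b: "x0 < ?b" using x0 s M by simp
  have cont: "continuous_on {0..?b} ?h" using continuous_on_JL_profile[of s M] s M by simp
  obtain x4 x3 where a: "0 < x4" "x4 \<le> x3" "x3 < x0" "?h x4 = l / 2" "?h x3 = l / 2"
    "\<And>x. 0 \<le> x \<Longrightarrow> x < x4 \<Longrightarrow> ?h x < l / 2" "\<And>x. x3 < x \<Longrightarrow> x \<le> x0 \<Longrightarrow> l / 2 < ?h x"
    by (rule crossing_up[of 0 x0 ?h "l / 2"])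
       (use continuous_on_subset[OF cont] x0 x0b h in auto)
  obtain x2 x1 where b: "x0 < x2" "x2 \<le> x1" "x1 < ?b" "?h x2 = l / 2" "?h x1 = l / 2"
    "\<And>x. x0 \<le> x \<Longrightarrow> x < x2 \<Longrightarrow> l / 2 < ?h x" "\<And>x. x1 < x \<Longrightarrow> x \<le> ?b \<Longrightarrow> ?h x < l / 2"
    by (rule crossing_down[of x0 ?b ?h "l / 2"])
       (use continuous_on_subset[OF cont] JL_profile_right_end[of s M] s M l x0 x0b h in auto)
  note iff = JL_iff_profile[of s N l, folded M_def, OF s(1) _ l']
  note q = exponent_of[OF l']
  have pos: "0 < x1" "0 < x2" "0 < x3" "0 < x4" using a(1,2,3) b(1,2) by linarith+
  have crit: "JL_critical N s l (?q x)" if "0 < x" "x < ?b" "?h x = l / 2" for x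
    using iff(3)[of "?q x", unfolded q(2)[OF that(1)]] q(1)[OF that(1)] s M that(2,3) by simp
  have crits: "JL_critical N s l (?q x1)" "JL_critical N s l (?q x2)"
    "JL_critical N s l (?q x3)" "JL_critical N s l (?q x4)"
    using a(1-5) b(1-5) pos x0b by (intro crit; linarith)+
  have sub1: "JL_subcritical N s l p" if "1 < p" "p < ?q x1" for p
    using iff(1)[of p] that q(5)[OF pos(1)] s M b(7)[of "(s + l / 2) / (p - 1)"] by fastforce
  have sub4: "JL_subcritical N s l p" if "?q x4 < p" for p
  proof -
    have p: "1 < p" using that q(1)[OF pos(4)] by simp
    moreover have "0 < (s + l / 2) / (p - 1)" using p l' by simp
    ultimately show ?thesis
      using iff(1)[of p] that q(6)[OF pos(4), of p] s M a(6) by auto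
  qed
  have super: "JL_supercritical N s l p" if "?q x2 < p" "p < ?q x3" for p
  proof -
    define x where "x = (s + l / 2) / (p - 1)"
    have p: "1 < p" using that q(1)[OF pos(2)] by simp
    have x: "x3 < x" "x < x2"
      using that q(5)[OF pos(3) p] q(6)[OF pos(2) p] by (auto simp: x_def)
    then have "l / 2 < ?h x" using a(7)[of x] b(6)[of x] by linarith
    then show ?thesis
      using iff(2)[of p, folded x_def] p x b(2,3) s M by simp
  qed
  have "?q x1 \<le> ?q x2" "?q x2 < ?q x3" "?q x3 \<le> ?q x4"
    using q(3,4) pos a(2,3) b(1,2) by auto
  moreover have "p_S N s l < ?q x1" using crits(1) by (simp add: JL_critical_def)
  ultimately show ?thesis using crits sub1 sub4 super by blast
qed

theorem theorem1p3:
  fixes N :: nat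
  assumes "N \<ge> 8"
  shows
    "(\<exists>(s_til::real) (l1::real \<Rightarrow> real) (l2::real \<Rightarrow> real).
        0 < s_til \<and> s_til < 1 \<and>
        (\<forall>s. 0 < s \<and> s < s_til \<longrightarrow> 0 < l1 s \<and> l1 s < l2 s) \<and>
        (\<forall>s l. 0 < s \<and> s < s_til \<and> 0 < l \<and> l < l1 s \<longrightarrow>
           (\<exists>p1 p2. p_S N s l < p1 \<and> p1 \<le> p2 \<and>
              (\<forall>p. 1 < p \<and> p < p1 \<longrightarrow> JL_subcritical N s l p) \<and>
              (\<forall>p. p2 < p \<longrightarrow> JL_supercritical N s l p) \<and>
              JL_critical N s l p1 \<and> JL_critical N s l p2)) \<and>
        (\<forall>s l. 0 < s \<and> s < s_til \<and> l1 s < l \<and> l < l2 s \<longrightarrow>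
           (\<exists>p1 p2 p3 p4. p_S N s l < p1 \<and> p1 \<le> p2 \<and> p2 < p3 \<and> p3 \<le> p4 \<and>
              (\<forall>p. (1 < p \<and> p < p1) \<or> p4 < p \<longrightarrow> JL_subcritical N s l p) \<and>
              (\<forall>p. p2 < p \<and> p < p3 \<longrightarrow> JL_supercritical N s l p) \<and>
              JL_critical N s l p1 \<and> JL_critical N s l p2 \<and>
              JL_critical N s l p3 \<and> JL_critical N s l p4)))
     \<and> (N \<ge> 10 \<longrightarrow>
        (\<exists>l3::real \<Rightarrow> real. \<forall>s l. 0 < s \<and> s < 1 \<and> l > - 2 * s \<and> l \<ge> l3 s \<longrightarrow>
           (\<forall>p>1. JL_subcritical N s l p)))
     \<and> (N \<in> {8, 9} \<longrightarrow>
        (\<forall>sN. is_s_threshold N sN \<longrightarrow>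
          (\<exists>l3::real \<Rightarrow> real. \<forall>s l. 0 < s \<and> s < sN \<and> l > - 2 * s \<and> l \<ge> l3 s \<longrightarrow>
             (\<forall>p>1. JL_subcritical N s l p))))"
proof -
  define M where "M = real N / 2"
  have "M \<ge> 4" using assms by (simp add: M_def)
  then obtain x0 d where x0: "0 < x0" "x0 < 1" and d: "0 < d" "d < 1" and
    h: "\<And>s. 0 < s \<Longrightarrow> s < d \<Longrightarrow> 0 < JL_profile M s 0 \<and> JL_profile M s 0 < JL_profile M s x0"
    by (rule JL_profile_small_s) blast
  define l1 l2 where "l1 = (\<lambda>s. 2 * JL_profile M s 0)" and "l2 = (\<lambda>s. 2 * JL_profile M s x0)"
  have order: "0 < l1 s \<and> l1 s < l2 s" if "0 < s" "s < d" for s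
    using h[OF that] by (simp add: l1_def l2_def)
  have small: "\<exists>p1 p2. p_S N s l < p1 \<and> p1 \<le> p2 \<and>
              (\<forall>p. 1 < p \<and> p < p1 \<longrightarrow> JL_subcritical N s l p) \<and>
              (\<forall>p. p2 < p \<longrightarrow> JL_supercritical N s l p) \<and>
              JL_critical N s l p1 \<and> JL_critical N s l p2"
    if "0 < s" "s < d" "0 < l" "l < l1 s" for s l
    using that d by (intro exponents_small_l assms) (simp_all add: l1_def M_def)
  have intermediate: "\<exists>p1 p2 p3 p4. p_S N s l < p1 \<and> p1 \<le> p2 \<and> p2 < p3 \<and> p3 \<le> p4 \<and>
              (\<forall>p. (1 < p \<and> p < p1) \<or> p4 < p \<longrightarrow> JL_subcritical N s l p) \<and>
              (\<forall>p. p2 < p \<and> p < p3 \<longrightarrow> JL_supercritical N s l p) \<and>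
              JL_critical N s l p1 \<and> JL_critical N s l p2 \<and>
              JL_critical N s l p3 \<and> JL_critical N s l p4"
    if "0 < s" "s < d" "l1 s < l" "l < l2 s" for s l
    using that d order[OF that(1,2)] x0
    by (intro exponents_intermediate_l[where ?x0.0 = x0] assms) (simp_all add: l1_def l2_def M_def)
  obtain l3 where l3: "\<And>s l. 0 < s \<Longrightarrow> s < 1 \<Longrightarrow> l > - 2 * s \<Longrightarrow> l \<ge> l3 s \<Longrightarrow>
      \<forall>p>1. JL_subcritical N s l p"
    using subcritical_if_l_large[OF _ _ assms] by metis
  have first: "0 < d \<and> d < 1 \<and>
        (\<forall>s. 0 < s \<and> s < d \<longrightarrow> 0 < l1 s \<and> l1 s < l2 s) \<and>
        (\<forall>s l. 0 < s \<and> s < d \<and> 0 < l \<and> l < l1 s \<longrightarrow>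
           (\<exists>p1 p2. p_S N s l < p1 \<and> p1 \<le> p2 \<and>
              (\<forall>p. 1 < p \<and> p < p1 \<longrightarrow> JL_subcritical N s l p) \<and>
              (\<forall>p. p2 < p \<longrightarrow> JL_supercritical N s l p) \<and>
              JL_critical N s l p1 \<and> JL_critical N s l p2)) \<and>
        (\<forall>s l. 0 < s \<and> s < d \<and> l1 s < l \<and> l < l2 s \<longrightarrow>
           (\<exists>p1 p2 p3 p4. p_S N s l < p1 \<and> p1 \<le> p2 \<and> p2 < p3 \<and> p3 \<le> p4 \<and>
              (\<forall>p. (1 < p \<and> p < p1) \<or> p4 < p \<longrightarrow> JL_subcritical N s l p) \<and>
              (\<forall>p. p2 < p \<and> p < p3 \<longrightarrow> JL_supercritical N s l p) \<and>
              JL_critical N s l p1 \<and> JL_critical N s l p2 \<and>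
              JL_critical N s l p3 \<and> JL_critical N s l p4))"
    using d order small intermediate by simp
  show ?thesis
  proof (intro conjI impI allI)
    show "\<exists>l3::real \<Rightarrow> real. \<forall>s l. 0 < s \<and> s < 1 \<and> l > - 2 * s \<and> l \<ge> l3 s \<longrightarrow>
           (\<forall>p>1. JL_subcritical N s l p)"
      using l3 by blast
  next
    fix sN assume "is_s_threshold N sN"
    then have "sN < 1" by (simp add: is_s_threshold_def)
    then show "\<exists>l3::real \<Rightarrow> real. \<forall>s l. 0 < s \<and> s < sN \<and> l > - 2 * s \<and> l \<ge> l3 s \<longrightarrow>
             (\<forall>p>1. JL_subcritical N s l p)"
      using l3 by (meson less_trans)
  qed (rule exI[of _ d], rule exI[of _ l1], rule exI[of _ l2], rule first)
qed

end
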